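(* Let $\alpha\in(0,1)$, $1\le q\le p\le\infty$ and $\alpha>\frac1p$. Then there exists $f\in B^\alpha_{pq}([0,1])$ (real-valued) such that $f\notin\mathcal V^r([0,1])$ for any $1\le r<\frac1\alpha$.
   Context: For measurable $f:[0,1]\to\mathbb R$, $\omega_p(f,\tau)=\sup_{0\le h\le\tau}\big(\int_0^{1-h}|f_{s+h}-f_s|^p\,ds\big)^{1/p}$, $[f]_{B^\alpha_{pq}([0,1])}=\big[\int_0^1(\omega_p(f,\tau)/\tau^\alpha)^q\frac{d\tau}\tau\big]^{1/q}$ (suprema when an exponent is $\infty$), and $f\in B^\alpha_{pq}([0,1])$ iff $f\in L^p$ and $[f]_{B^\alpha_{pq}}<\infty$. For $\alpha>1/p$ elements of $B^\alpha_{pq}$ are represented by their continuous version. $\mathcal V^r([0,1])$ is the set of $f:[0,1]\to\mathbb R$ of finite $r$-variation: $\sup_P\big(\sum_i|f_{t_i}-f_{t_{i-1}}|^r\big)^{1/r}<\infty$, supremum over partitions $P=\{0=t_0<\dots<t_N=1\}$. *)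

theory Defs
  imports "HOL-Analysis.Analysis"
begin

text \<open>
  Functions on $[0,1]$ are represented by functions of type \<^typ>\<open>real \<Rightarrow> real\<close>; every definition
  below only looks at their values on \<^term>\<open>{0..1::real}\<close>.  Integrability exponents range over
  $[1,\infty]$ and are of type \<^typ>\<open>ennreal\<close>; the quantities that are possibly infinite (moduli,
  seminorms, variations) are valued in \<^typ>\<open>ennreal\<close>.
\<close>

text \<open>Real powers on $[0,\infty]$; used for exponents \<open>a > 0\<close> only, so that $\infty^a = \infty$.\<close>

definition enn_powr :: "ennreal \<Rightarrow> real \<Rightarrow> ennreal" where
  "enn_powr x a = (if x = \<infinity> then \<infinity> else ennreal (enn2real x powr a))"

text \<open>
  For $p = \infty$ the inner norm is taken as a supremum over \<open>s\<close>.  It dominates the essential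
  supremum, and for continuous \<open>f\<close> both yield the same modulus, hence the same seminorm.
\<close>

definition modulus :: "ennreal \<Rightarrow> (real \<Rightarrow> real) \<Rightarrow> real \<Rightarrow> ennreal" where
  "modulus p f \<tau> =
    (SUP h\<in>{0..\<tau>}.
      if p = \<infinity> then (SUP s\<in>{0..1 - h}. ennreal \<bar>f (s + h) - f s\<bar>)
      else enn_powr (\<integral>\<^sup>+s\<in>{0..1 - h}. ennreal (\<bar>f (s + h) - f s\<bar> powr enn2real p) \<partial>lebesgue)
             (1 / enn2real p))"

definition besov_seminorm :: "real \<Rightarrow> ennreal \<Rightarrow> ennreal \<Rightarrow> (real \<Rightarrow> real) \<Rightarrow> ennreal" where
  "besov_seminorm \<alpha> p q f =
    (if q = \<infinity> then (SUP \<tau>\<in>{0<..1}. modulus p f \<tau> / ennreal (\<tau> powr \<alpha>))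
     else enn_powr
            (\<integral>\<^sup>+\<tau>\<in>{0<..1}. enn_powr (modulus p f \<tau> / ennreal (\<tau> powr \<alpha>)) (enn2real q) / ennreal \<tau>
               \<partial>lebesgue)
            (1 / enn2real q))"

definition Lp_space :: "ennreal \<Rightarrow> (real \<Rightarrow> real) set" where
  "Lp_space p =
    {f \<in> borel_measurable (lebesgue_on {0..1}).
      if p = \<infinity> then (\<exists>C. AE s in lebesgue_on {0..1}. \<bar>f s\<bar> \<le> C)
      else (\<integral>\<^sup>+s\<in>{0..1}. ennreal (\<bar>f s\<bar> powr enn2real p) \<partial>lebesgue) < \<infinity>}"

definition besov :: "real \<Rightarrow> ennreal \<Rightarrow> ennreal \<Rightarrow> (real \<Rightarrow> real) set" where
  "besov \<alpha> p q = {f \<in> Lp_space p. besov_seminorm \<alpha> p q f < \<infinity>}"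

text \<open>The partition points are \<open>t 0, \<dots>, t N\<close>; values of \<open>t\<close> beyond \<open>N\<close> are irrelevant.\<close>

definition partition01 :: "nat \<Rightarrow> (nat \<Rightarrow> real) \<Rightarrow> bool" where
  "partition01 N t \<longleftrightarrow> t 0 = 0 \<and> t N = 1 \<and> (\<forall>i<N. t i < t (Suc i))"

definition variation :: "real \<Rightarrow> (real \<Rightarrow> real) \<Rightarrow> ennreal" where
  "variation r f =
    (SUP (N, t)\<in>{(N, t). partition01 N t}.
      ennreal ((\<Sum>i<N. \<bar>f (t (Suc i)) - f (t i)\<bar> powr r) powr (1 / r)))"

definition finite_variation :: "real \<Rightarrow> (real \<Rightarrow> real) set" where
  "finite_variation r = {f. variation r f < \<infinity>}"

end

theory Submission
  imports Defs "HOL-Real_Asymp.Real_Asymp"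
begin

text \<open>
  A single Takagi-type function $f(x) = \sum_n a_n\,d(2^n x, \mathbb Z)$ with
  $a_n = 2^{-\alpha n}/(n+1)^2$ works for all \<open>p\<close>, \<open>q\<close> and \<open>r\<close>.  Its uniform modulus of continuity
  is at most $W(\tau) = \sum_n a_n \min(1, 2^n\tau)$.  The quotient $W(\tau)/\tau^\alpha$ is bounded,
  so its \<open>q\<close>-th power is dominated by a multiple of itself, and integrating the series
  termwise against $d\tau/\tau$ gives a multiple of $\sum_n (n+1)^{-2}$.  On the other hand, the
  second difference of \<open>f\<close> over a dyadic interval of length $2^{-n}$ is exactly $-a_n$, because
  coarser terms are affine there and finer ones vanish at both ends and at the midpoint.
  Hence the \<open>r\<close>-variation is at least $2^{n/r} a_n/2$, which is unbounded for $r < 1/\alpha$.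
\<close>

section \<open>The distance to the nearest integer\<close>

definition int_dist :: "real \<Rightarrow> real" where
  "int_dist x = \<bar>x - of_int (round x)\<bar>"

lemma int_dist_nonneg: "0 \<le> int_dist x"
  by (simp add: int_dist_def)

lemma int_dist_le_half: "int_dist x \<le> 1/2"
  using of_int_round_abs_le[of x] by (simp add: int_dist_def abs_minus_commute)

lemma int_dist_le: "int_dist x \<le> \<bar>x - of_int m\<bar>"
  unfolding int_dist_def by (rule round_diff_minimal)

lemma int_dist_le_add: "int_dist x \<le> \<bar>x - y\<bar> + int_dist y"
  using int_dist_le[of x "round y"] by (simp add: int_dist_def)

lemma int_dist_lipschitz: "\<bar>int_dist x - int_dist y\<bar> \<le> \<bar>x - y\<bar>"
  using int_dist_le_add[of x y] int_dist_le_add[of y x] by linarith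

text \<open>The Lipschitz bound is the useful one for close points, the bound 1 for distant ones.
  Keeping both is what lets the increments be integrated against the Besov weight with the scaling
  found in \<open>nn_integral_min_powr_le\<close>.\<close>

lemma int_dist_diff_le_min: "\<bar>int_dist x - int_dist y\<bar> \<le> min 1 \<bar>x - y\<bar>"
  using int_dist_lipschitz[of x y] int_dist_nonneg[of x] int_dist_nonneg[of y]
    int_dist_le_half[of x] int_dist_le_half[of y] by (auto simp: abs_le_iff)

lemma int_dist_of_nat [simp]: "int_dist (of_nat m) = 0"
  by (simp add: int_dist_def)

lemma int_dist_eq_right:
  assumes "of_int c \<le> x" "x \<le> of_int c + 1/2"
  shows "int_dist x = x - of_int c"
proof -
  have "\<bar>x - of_int c\<bar> \<le> \<bar>x - of_int m\<bar>" for m :: int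
  proof (cases "m \<le> c")
    case True
    then have "real_of_int m \<le> of_int c" by simp
    then show ?thesis using assms by linarith
  next
    case False
    then have "real_of_int m \<ge> of_int c + 1" by linarith
    then show ?thesis using assms by linarith
  qed
  then show ?thesis
    using int_dist_le[of x c] assms unfolding int_dist_def by (metis abs_of_nonneg diff_ge_0_iff_ge order_antisym)
qed

lemma int_dist_minus: "int_dist (- x) = int_dist x"
proof (rule antisym)
  show "int_dist (- x) \<le> int_dist x"
    using int_dist_le[of "- x" "- round x"] by (simp add: int_dist_def)
  show "int_dist x \<le> int_dist (- x)"
    using int_dist_le[of "x" "- round (- x)"] by (simp add: int_dist_def)
qed

lemma int_dist_eq_left:
  assumes "of_int c - 1/2 \<le> x" "x \<le> of_int c"
  shows "int_dist x = of_int c - x"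
  using int_dist_eq_right[of "- c" "- x"] assms by (simp add: int_dist_minus)

text \<open>Between consecutive half-integers \<open>int_dist\<close> is affine, with slope 1 if
  \<open>l\<close> is even and -1 if \<open>l\<close> is odd, and an affine function takes the mean
  value at a midpoint.\<close>

lemma int_dist_midpoint:
  fixes l :: int
  assumes "of_int l / 2 \<le> x" "x \<le> y" "y \<le> (of_int l + 1) / 2"
  shows "int_dist x + int_dist y = 2 * int_dist ((x + y) / 2)"
proof (cases "even l")
  case True
  then obtain c where "l = 2 * c" by blast
  then show ?thesis
    using assms by (simp add: int_dist_eq_right[where c = c])
next
  case False
  then obtain c where "l = 2 * c + 1" by (elim oddE)
  then show ?thesis
    using assms by (simp add: int_dist_eq_left[where c = "c + 1"] field_simps)
qed

text \<open>The grid of step \<open>d\<close> refines the half-integers, so two neighbouring grid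
  points never lie on opposite sides of a kink. This is the case of the coarse terms in
  \<open>takagi_second_difference\<close>.\<close>

lemma int_dist_dyadic_midpoint:
  fixes k i :: nat and d :: real
  defines "d \<equiv> 1 / 2 ^ Suc i"
  shows "int_dist (k * d) + int_dist (Suc k * d) = 2 * int_dist (real (2 * k + 1) * d / 2)"
proof -
  \<comment> \<open>Since \<open>k * d\<close> is half of \<open>k / 2 ^ i\<close>, this quotient
    numbers the half-integer interval that contains both grid points.\<close>
  define l where "l = k div 2 ^ i"
  have "l * 2 ^ i \<le> k" "Suc k \<le> (l + 1) * 2 ^ i"
    unfolding l_def by (simp, metis Suc_leI add.commute dividend_less_times_div mult.commute
        mult_Suc_right plus_1_eq_Suc zero_less_numeral zero_less_power)
  then have "real (l * 2 ^ i) \<le> real k" "real (Suc k) \<le> real ((l + 1) * 2 ^ i)"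
    by (simp_all only: of_nat_le_iff)
  then have "real l / 2 \<le> k * d" "Suc k * d \<le> (real l + 1) / 2"
    by (simp_all add: d_def field_simps)
  moreover have "real k * d \<le> Suc k * d" by (intro mult_right_mono) (simp_all add: d_def)
  ultimately have "int_dist (k * d) + int_dist (Suc k * d) = 2 * int_dist ((k * d + Suc k * d) / 2)"
    by (intro int_dist_midpoint[of "int l"]) auto
  also have "(k * d + Suc k * d) / 2 = (2 * k + 1) * d / 2"
    by (simp add: algebra_simps)
  finally show ?thesis .
qed

section \<open>Takagi-type functions\<close>

text \<open>The coefficients \<open>a n = 1 / 2 ^ n\<close> give the classical Takagi (blancmange)
  function.\<close>

definition takagi :: "(nat \<Rightarrow> real) \<Rightarrow> real \<Rightarrow> real" where
  "takagi a x = (\<Sum>n. a n * int_dist (2 ^ n * x))"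

context
  fixes a :: "nat \<Rightarrow> real"
  assumes a_nonneg: "\<And>n. 0 \<le> a n" and a_summable: "summable a"
begin

lemma takagi_summable: "summable (\<lambda>n. a n * int_dist (2 ^ n * x))"
proof (rule summable_comparison_test'[OF a_summable])
  fix n :: nat
  show "norm (a n * int_dist (2 ^ n * x)) \<le> a n"
    using int_dist_nonneg[of "2 ^ n * x"] int_dist_le_half[of "2 ^ n * x"] a_nonneg[of n]
    by (simp add: abs_mult mult_left_le)
qed

lemma takagi_modulus_summable: "summable (\<lambda>n. a n * min 1 (2 ^ n * \<bar>h\<bar>))"
  by (rule summable_comparison_test'[OF a_summable]) (simp add: a_nonneg abs_mult mult_left_le)

text \<open>Apply \<open>int_dist_diff_le_min\<close> to each term. The bound depends on the
  distance of the points only and holds on the whole real line, so it bounds increments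
  uniformly.\<close>

lemma takagi_diff_le:
  "\<bar>takagi a x - takagi a y\<bar> \<le> (\<Sum>n. a n * min 1 (2 ^ n * \<bar>x - y\<bar>))"
proof -
  have "takagi a x - takagi a y = (\<Sum>n. a n * (int_dist (2 ^ n * x) - int_dist (2 ^ n * y)))"
    unfolding takagi_def
    by (subst suminf_diff[OF takagi_summable takagi_summable]) (simp add: right_diff_distrib)
  moreover have bound: "norm (a n * (int_dist (2 ^ n * x) - int_dist (2 ^ n * y)))
      \<le> a n * min 1 (2 ^ n * \<bar>x - y\<bar>)" for n
  proof -
    have "\<bar>2 ^ n * x - 2 ^ n * y\<bar> = 2 ^ n * \<bar>x - y\<bar>"
      by (simp add: abs_mult flip: right_diff_distrib)
    then show ?thesis
      using int_dist_diff_le_min[of "2 ^ n * x" "2 ^ n * y"] a_nonneg[of n]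
      by (simp add: abs_mult mult_left_mono)
  qed
  ultimately show ?thesis
    using norm_suminf_le[OF bound takagi_modulus_summable] by simp
qed

text \<open>The second difference is taken term by term, and only the term of index \<open>n\<close>
  survives. There the endpoints are scaled to integers and the midpoint to a half-integer, which
  contributes \<open>0 + 0 - 2 * (a n * (1/2))\<close>.\<close>

lemma takagi_second_difference:
  "takagi a (k / 2 ^ n) + takagi a (Suc k / 2 ^ n) - 2 * takagi a (real (2 * k + 1) / 2 ^ Suc n) = - a n"
proof -
  define c where "c = (\<lambda>m. a m * int_dist (2 ^ m * (k / 2 ^ n)) + a m * int_dist (2 ^ m * (Suc k / 2 ^ n))
      - 2 * (a m * int_dist (2 ^ m * (real (2 * k + 1) / 2 ^ Suc n))))"
  have "c sums (takagi a (k / 2 ^ n) + takagi a (Suc k / 2 ^ n) - 2 * takagi a (real (2 * k + 1) / 2 ^ Suc n))"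
    unfolding c_def takagi_def
    by (intro sums_diff sums_add sums_mult summable_sums takagi_summable)
  moreover have "c sums (- a n)"
  proof -
    have "c m = (if m = n then - a n else 0)" for m
    proof -
      consider "m < n" | "m = n" | "n < m" by linarith
      then show ?thesis
      proof cases
        case 1
        then obtain i where n: "n = m + Suc i"
          using less_imp_Suc_add by auto
        \<comment> \<open>After scaling by \<open>2 ^ m\<close> the interval has length
          \<open>1 / 2 ^ Suc i\<close>, at most 1/2, as \<open>int_dist_dyadic_midpoint\<close>
          requires.\<close>
        have e: "2 ^ m * (z / 2 ^ n) = z * (1 / 2 ^ Suc i)"
          "2 ^ m * (z / 2 ^ Suc n) = z * (1 / 2 ^ Suc i) / 2" for z :: real
          by (simp_all add: n power_add)
        have "c m = a m * (int_dist (k * (1 / 2 ^ Suc i)) + int_dist (Suc k * (1 / 2 ^ Suc i))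
            - 2 * int_dist (real (2 * k + 1) * (1 / 2 ^ Suc i) / 2))"
          unfolding c_def e by (simp only: algebra_simps)
        then show ?thesis
          using 1 by (simp only: int_dist_dyadic_midpoint) simp
      next
        case 2
        have "int_dist (k + 1/2) = 1/2"
          using int_dist_eq_right[of "int k" "k + 1/2"] by simp
        moreover have "2 ^ n * (real (2 * k + 1) / 2 ^ Suc n) = k + 1/2"
          by (simp add: field_simps)
        moreover have "2 ^ n * (k / 2 ^ n) = k" "2 ^ n * (Suc k / 2 ^ n) = Suc k"
          by simp_all
        ultimately show ?thesis
          using 2 unfolding c_def by (simp only: int_dist_of_nat) simp
      next
        case 3
        then obtain i where m: "m = n + Suc i"
          using less_imp_Suc_add by auto
        \<comment> \<open>As \<open>m\<close> is at least \<open>Suc n\<close>, the midpoint too is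
          scaled to an integer, so all three values vanish.\<close>
        have e: "2 ^ m * (k / 2 ^ n) = real (2 ^ Suc i * k)"
          "2 ^ m * (Suc k / 2 ^ n) = real (2 ^ Suc i * Suc k)"
          "2 ^ m * (real (2 * k + 1) / 2 ^ Suc n) = real (2 ^ i * (2 * k + 1))"
          by (simp_all add: m power_add field_simps)
        show ?thesis
          using 3 unfolding c_def e by (simp only: int_dist_of_nat) simp
      qed
    qed
    then have "c = (\<lambda>m. if m = n then - a n else 0)" by blast
    then show ?thesis
      using sums_single[of n "\<lambda>_. - a n"] by simp
  qed
  ultimately show ?thesis
    by (rule sums_unique2)
qed

section \<open>Lower bound for the variation\<close>

text \<open>The second difference \<open>- a n\<close> equals \<open>?v - ?u\<close>, so one of the
  two half-interval increments has size at least \<open>a n / 2\<close>; the other is bounded below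
  by 0.\<close>

lemma takagi_increments_ge:
  assumes "1 \<le> r"
  shows "(a n / 2) powr r \<le> \<bar>takagi a (real (2 * k + 1) / 2 ^ Suc n) - takagi a (k / 2 ^ n)\<bar> powr r
    + \<bar>takagi a (Suc k / 2 ^ n) - takagi a (real (2 * k + 1) / 2 ^ Suc n)\<bar> powr r"
    (is "_ \<le> \<bar>?u\<bar> powr r + \<bar>?v\<bar> powr r")
proof -
  have "a n / 2 \<le> \<bar>?u\<bar> \<or> a n / 2 \<le> \<bar>?v\<bar>"
    using takagi_second_difference[of k n] by linarith
  then show ?thesis
  proof
    assume "a n / 2 \<le> \<bar>?u\<bar>"
    then have "(a n / 2) powr r \<le> \<bar>?u\<bar> powr r"
      using assms a_nonneg by (intro powr_mono2) auto
    then show ?thesis by (simp add: add_increasing2)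
  next
    assume "a n / 2 \<le> \<bar>?v\<bar>"
    then have "(a n / 2) powr r \<le> \<bar>?v\<bar> powr r"
      using assms a_nonneg by (intro powr_mono2) auto
    then show ?thesis by (simp add: add_increasing)
  qed
qed

text \<open>Partition into dyadic intervals of length \<open>1 / 2 ^ Suc n\<close>. Their increments
  group into \<open>2 ^ n\<close> pairs, each contributing at least
  \<open>(a n / 2) powr r\<close>.\<close>

lemma takagi_variation_ge:
  assumes "1 \<le> r"
  shows "ennreal (2 powr (n / r) * (a n / 2)) \<le> variation r (takagi a)"
proof -
  define t where "t = (\<lambda>i. real i / 2 ^ Suc n)"
  define g where "g = (\<lambda>i. \<bar>takagi a (t (Suc i)) - takagi a (t i)\<bar> powr r)"
  have "partition01 (2 * 2 ^ n) t"
    by (simp add: partition01_def t_def divide_strict_right_mono)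
  then have le: "ennreal (sum g {..<2 * 2 ^ n} powr (1 / r)) \<le> variation r (takagi a)"
    unfolding variation_def g_def
    by (intro SUP_upper2[where i = "(2 * 2 ^ n, t)"]) auto
  \<comment> \<open>An even index and its successor are the two halves of one dyadic interval of
    length \<open>1 / 2 ^ n\<close>.\<close>
  have pair: "sum g {..<2 * M} = (\<Sum>k<M. g (2 * k) + g (2 * k + 1))" for M :: nat
    by (induction M) auto
  have "(a n / 2) powr r \<le> g (2 * k) + g (2 * k + 1)" for k
  proof -
    have "t (2 * k) = k / 2 ^ n" "t (2 * k + 1) = real (2 * k + 1) / 2 ^ Suc n"
      "t (Suc (2 * k + 1)) = Suc k / 2 ^ n"
      by (simp_all add: t_def field_simps)
    then show ?thesis
      using takagi_increments_ge[OF assms, of n k] by (simp only: g_def flip: Suc_eq_plus1)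
  qed
  then have "(\<Sum>k<(2::nat) ^ n. (a n / 2) powr r) \<le> sum g {..<2 * 2 ^ n}"
    unfolding pair by (intro sum_mono)
  then have "2 ^ n * (a n / 2) powr r \<le> sum g {..<2 * 2 ^ n}"
    by simp
  then have "(2 ^ n * (a n / 2) powr r) powr (1 / r) \<le> sum g {..<2 * 2 ^ n} powr (1 / r)"
    using assms by (intro powr_mono2) auto
  moreover have "(2 ^ n * (a n / 2) powr r) powr (1 / r) = 2 powr (n / r) * (a n / 2)"
    using assms a_nonneg[of n] by (simp add: powr_mult powr_powr flip: powr_realpow)
  ultimately show ?thesis
    using le by (metis ennreal_leI order_trans)
qed

end

section \<open>Besov functions with uniformly controlled increments\<close>

lemma enn_powr_mono:
  assumes "x \<le> y" "0 \<le> b"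
  shows "enn_powr x b \<le> enn_powr y b"
proof (cases "y = \<infinity>")
  case False
  then have "x \<noteq> \<infinity>" using assms by (auto simp: top_unique)
  moreover have "enn2real x \<le> enn2real y"
    using assms False by (intro enn2real_mono) (auto simp: less_top)
  ultimately show ?thesis
    using assms False by (auto simp: enn_powr_def intro!: ennreal_leI powr_mono2)
qed (simp add: enn_powr_def)

lemma enn_powr_ennreal: "0 \<le> x \<Longrightarrow> enn_powr (ennreal x) b = ennreal (x powr b)"
  by (simp add: enn_powr_def)

lemma enn_powr_finite: "x < \<infinity> \<Longrightarrow> enn_powr x b < \<infinity>"
  by (simp add: enn_powr_def)

text \<open>The domain of integration lies in the unit interval, of measure 1, so a uniform bound on
  the increments bounds their norm for every \<open>p\<close> with the same constant.\<close>

lemma modulus_le: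
  assumes "1 \<le> p" "0 \<le> W"
    and inc: "\<And>s h. 0 \<le> h \<Longrightarrow> h \<le> \<tau> \<Longrightarrow> \<bar>f (s + h) - f s\<bar> \<le> W"
  shows "modulus p f \<tau> \<le> ennreal W"
  unfolding modulus_def
proof (rule SUP_least)
  fix h assume "h \<in> {0..\<tau>}"
  then have h: "0 \<le> h" "\<bar>f (s + h) - f s\<bar> \<le> W" for s
    using inc by auto
  show "(if p = \<infinity> then (SUP s\<in>{0..1 - h}. ennreal \<bar>f (s + h) - f s\<bar>)
      else enn_powr (\<integral>\<^sup>+s\<in>{0..1 - h}. ennreal (\<bar>f (s + h) - f s\<bar> powr enn2real p) \<partial>lebesgue)
             (1 / enn2real p)) \<le> ennreal W"
  proof (cases "p = \<infinity>")
    case True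
    then show ?thesis using h by (auto intro!: SUP_least ennreal_leI)
  next
    case False
    define b where "b = enn2real p"
    have b: "1 \<le> b"
      using enn2real_mono[OF assms(1)] False by (simp add: b_def less_top)
    have "(\<integral>\<^sup>+s\<in>{0..1 - h}. ennreal (\<bar>f (s + h) - f s\<bar> powr b) \<partial>lebesgue)
        \<le> (\<integral>\<^sup>+s. ennreal (W powr b) * indicator {0..1::real} s \<partial>lebesgue)"
      using h b
      by (intro nn_integral_mono) (auto simp: indicator_def intro!: ennreal_leI powr_mono2)
    also have "\<dots> = ennreal (W powr b)"
      by (subst nn_integral_cmult_indicator) auto
    finally have "enn_powr (\<integral>\<^sup>+s\<in>{0..1 - h}. ennreal (\<bar>f (s + h) - f s\<bar> powr b) \<partial>lebesgue) (1 / b)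
        \<le> enn_powr (ennreal (W powr b)) (1 / b)"
      using b by (intro enn_powr_mono) auto
    also have "\<dots> = ennreal W"
      using b assms(2) by (simp add: enn_powr_ennreal powr_powr)
    finally show ?thesis using False by (simp add: b_def)
  qed
qed

lemma continuous_imp_Lp_space:
  assumes "continuous_on {0..1} f"
  shows "f \<in> Lp_space p"
proof -
  have meas: "f \<in> borel_measurable (lebesgue_on {0..1})"
    using assms by (intro continuous_imp_measurable_on_sets_lebesgue) auto
  have "bounded (f ` {0..1})"
    using assms by (intro compact_imp_bounded compact_continuous_image) auto
  then obtain C where C: "\<And>s. s \<in> {0..1} \<Longrightarrow> \<bar>f s\<bar> \<le> C"
    unfolding bounded_iff by (metis image_eqI real_norm_def)
  have "AE s in lebesgue_on {0..1}. \<bar>f s\<bar> \<le> C"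
    using C by (intro AE_I2) simp
  \<comment> \<open>This also holds at \<open>p = \<infinity>\<close>, where
    \<open>enn2real p\<close> takes the default value 0, so both branches of \<open>Lp_space\<close>
    are served without a case split.\<close>
  moreover have "(\<integral>\<^sup>+s\<in>{0..1}. ennreal (\<bar>f s\<bar> powr enn2real p) \<partial>lebesgue) < \<infinity>"
  proof -
    have "(\<integral>\<^sup>+s\<in>{0..1}. ennreal (\<bar>f s\<bar> powr enn2real p) \<partial>lebesgue)
        \<le> (\<integral>\<^sup>+s. ennreal (C powr enn2real p) * indicator {0..1::real} s \<partial>lebesgue)"
      using C by (intro nn_integral_mono) (auto simp: indicator_def intro!: ennreal_leI powr_mono2)
    also have "\<dots> < \<infinity>"
      by (subst nn_integral_cmult_indicator) auto
    finally show ?thesis .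
  qed
  ultimately show ?thesis
    using meas by (auto simp: Lp_space_def)
qed

text \<open>Reduces every finite \<open>q\<close> to the exponent 1: if \<open>x\<close> lies
  between 0 and \<open>C\<close> and \<open>b\<close> is at least 1, then \<open>x powr b\<close> is
  at most \<open>C powr (b - 1) * x\<close>. Measurability is asked of the majorant
  \<open>W\<close>, because monotonicity of the nonnegative integral compares arbitrary
  functions.\<close>

lemma besov_seminorm_finite:
  assumes "1 \<le> q" "0 \<le> C"
    and bound: "\<And>\<tau>. 0 < \<tau> \<Longrightarrow> \<tau> \<le> 1 \<Longrightarrow> modulus p f \<tau> \<le> ennreal (W \<tau>)"
    and W: "\<And>\<tau>. 0 < \<tau> \<Longrightarrow> \<tau> \<le> 1 \<Longrightarrow> 0 \<le> W \<tau> \<and> W \<tau> \<le> C * \<tau> powr \<alpha>"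
    and int: "(\<integral>\<^sup>+\<tau>\<in>{0<..1}. ennreal (W \<tau> * \<tau> powr (-\<alpha> - 1)) \<partial>lebesgue) < \<infinity>"
    and [measurable]: "W \<in> borel_measurable borel"
  shows "besov_seminorm \<alpha> p q f < \<infinity>"
proof -
  have quot: "modulus p f \<tau> / ennreal (\<tau> powr \<alpha>) \<le> ennreal (W \<tau> / \<tau> powr \<alpha>)"
    and WC: "0 \<le> W \<tau> / \<tau> powr \<alpha>" "W \<tau> / \<tau> powr \<alpha> \<le> C" if "0 < \<tau>" "\<tau> \<le> 1" for \<tau>
  proof -
    show "modulus p f \<tau> / ennreal (\<tau> powr \<alpha>) \<le> ennreal (W \<tau> / \<tau> powr \<alpha>)"
      using divide_right_mono_ennreal[OF bound[OF that], of "ennreal (\<tau> powr \<alpha>)"] that W[OF that]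
      by (simp add: divide_ennreal)
  qed (use W[OF that] that in \<open>simp_all add: divide_simps\<close>)
  show ?thesis
  proof (cases "q = \<infinity>")
    case True
    have "modulus p f \<tau> / ennreal (\<tau> powr \<alpha>) \<le> ennreal C" if "0 < \<tau>" "\<tau> \<le> 1" for \<tau>
      using quot[OF that] ennreal_leI[OF WC(2)[OF that]] by (rule order_trans)
    then have "besov_seminorm \<alpha> p q f \<le> ennreal C"
      using True unfolding besov_seminorm_def by (auto intro!: SUP_least)
    then show ?thesis
      by (rule le_less_trans) simp
  next
    case False
    define b where "b = enn2real q"
    have b: "1 \<le> b"
      using enn2real_mono[OF assms(1)] False by (simp add: b_def less_top)
    have pt: "enn_powr (modulus p f \<tau> / ennreal (\<tau> powr \<alpha>)) b / ennreal \<tau>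
        \<le> ennreal (C powr (b - 1)) * ennreal (W \<tau> * \<tau> powr (-\<alpha> - 1))" if \<tau>: "0 < \<tau>" "\<tau> \<le> 1" for \<tau>
    proof -
      define x where "x = W \<tau> / \<tau> powr \<alpha>"
      have x: "0 \<le> x" "x \<le> C" using WC[OF \<tau>] by (simp_all add: x_def)
      have "x powr b = x powr (b - 1) * x"
        using x(1) powr_add[of x "b - 1" 1] by simp
      also have "\<dots> \<le> C powr (b - 1) * x"
        using x b by (intro mult_right_mono powr_mono2) auto
      finally have xb: "x powr b \<le> C powr (b - 1) * x" .
      have "enn_powr (modulus p f \<tau> / ennreal (\<tau> powr \<alpha>)) b / ennreal \<tau> \<le> enn_powr (ennreal x) b / ennreal \<tau>"
        using quot[OF \<tau>] b by (intro divide_right_mono_ennreal enn_powr_mono) (auto simp: x_def)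
      also have "\<dots> \<le> ennreal (C powr (b - 1) * x) / ennreal \<tau>"
        using x xb by (intro divide_right_mono_ennreal) (auto simp: enn_powr_ennreal ennreal_leI)
      also have "\<dots> = ennreal (C powr (b - 1) * (x / \<tau>))"
        using x \<tau> by (simp add: divide_ennreal)
      \<comment> \<open>The exponent collects the Besov weight and the density of the measure
        \<open>d\<tau> / \<tau>\<close>.\<close>
      also have "x / \<tau> = W \<tau> * \<tau> powr (-\<alpha> - 1)"
        using \<tau> by (simp add: x_def powr_diff powr_minus field_simps)
      finally show ?thesis
        using W[OF \<tau>] by (simp add: ennreal_mult)
    qed
    have "(\<integral>\<^sup>+\<tau>\<in>{0<..1}. enn_powr (modulus p f \<tau> / ennreal (\<tau> powr \<alpha>)) b / ennreal \<tau> \<partial>lebesgue)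
        \<le> (\<integral>\<^sup>+\<tau>. ennreal (C powr (b - 1)) *
              (ennreal (W \<tau> * \<tau> powr (-\<alpha> - 1)) * indicator {0<..1} \<tau>) \<partial>lebesgue)"
      using pt by (intro nn_integral_mono) (auto simp: indicator_def)
    also have "\<dots> = ennreal (C powr (b - 1)) *
        (\<integral>\<^sup>+\<tau>\<in>{0<..1}. ennreal (W \<tau> * \<tau> powr (-\<alpha> - 1)) \<partial>lebesgue)"
      by (intro nn_integral_cmult measurable_completion) measurable
    also have "\<dots> < \<infinity>"
      using int by (simp add: ennreal_mult_less_top)
    finally show ?thesis
      using False enn_powr_finite by (simp add: besov_seminorm_def b_def)
  qed
qed

section \<open>Besov regularity of Takagi-type functions\<close>

text \<open>Interpolates between the bounds 1 and \<open>x\<close>; it turns the series of truncated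
  linear bounds into a Hoelder bound.\<close>

lemma min_one_le_powr:
  fixes x \<alpha> :: real
  assumes "0 \<le> x" "0 < \<alpha>" "\<alpha> < 1"
  shows "min 1 x \<le> x powr \<alpha>"
proof (cases "x \<le> 1")
  case True
  then show ?thesis
    using powr_mono'[of \<alpha> 1 x] assms by simp
next
  case False
  then show ?thesis
    using ge_one_powr_ge_zero[of x \<alpha>] assms by simp
qed

text \<open>The substitution \<open>u = c * \<tau>\<close> explains the factor
  \<open>c powr \<alpha>\<close>. Splitting at \<open>1 / c\<close>, where the minimum changes
  branch, gives \<open>1 / (1 - \<alpha>)\<close> from the part near 0 and
  \<open>1 / \<alpha>\<close> from the tail.\<close>

lemma nn_integral_min_powr_le:
  assumes "0 < \<alpha>" "\<alpha> < 1" "0 < c"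
  shows "(\<integral>\<^sup>+\<tau>\<in>{0<..1}. ennreal (min 1 (c * \<tau>) * \<tau> powr (-\<alpha> - 1)) \<partial>lebesgue)
    \<le> ennreal (c powr \<alpha> * (1 / (1 - \<alpha>) + 1 / \<alpha>))"
proof -
  let ?d = "1 / c"
  have ind: "indicator A x * ennreal y = ennreal (indicator A x * y)" for A and x y :: real
    by (simp add: indicator_def)
  have I1: "(\<integral>\<^sup>+\<tau>. indicator {0..?d} \<tau> * ennreal (\<tau> powr (-\<alpha>)) \<partial>lebesgue)
      = ennreal (?d powr (1 - \<alpha>) / (1 - \<alpha>))"
    using has_integral_powr_from_0[of "-\<alpha>" ?d] assms
    by (subst nn_integral_completion) (auto simp: ind intro!: nn_integral_has_integral_lebesgue)
  \<comment> \<open>The tail is taken up to infinity rather than up to 1, so the estimate has the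
    same form for every positive \<open>c\<close>.\<close>
  have I2: "(\<integral>\<^sup>+\<tau>. indicator {?d..} \<tau> * ennreal (\<tau> powr (-\<alpha> - 1)) \<partial>lebesgue)
      = ennreal (?d powr (-\<alpha>) / \<alpha>)"
    using has_integral_powr_to_inf[of "-\<alpha> - 1" ?d] assms
    by (subst nn_integral_completion) (auto simp: ind intro!: nn_integral_has_integral_lebesgue)
  have "(\<integral>\<^sup>+\<tau>\<in>{0<..1}. ennreal (min 1 (c * \<tau>) * \<tau> powr (-\<alpha> - 1)) \<partial>lebesgue)
      \<le> (\<integral>\<^sup>+\<tau>. ennreal c * (indicator {0..?d} \<tau> * ennreal (\<tau> powr (-\<alpha>)))
          + indicator {?d..} \<tau> * ennreal (\<tau> powr (-\<alpha> - 1)) \<partial>lebesgue)"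
  proof (rule nn_integral_mono)
    fix \<tau> :: real
    show "ennreal (min 1 (c * \<tau>) * \<tau> powr (-\<alpha> - 1)) * indicator {0<..1} \<tau>
      \<le> ennreal c * (indicator {0..?d} \<tau> * ennreal (\<tau> powr (-\<alpha>)))
          + indicator {?d..} \<tau> * ennreal (\<tau> powr (-\<alpha> - 1))"
    proof (cases "0 < \<tau>")
      case True
      show ?thesis
      proof (cases "\<tau> \<le> ?d")
        case le: True
        have "c * \<tau> * \<tau> powr (-\<alpha> - 1) = c * \<tau> powr (-\<alpha>)"
          using True by (simp add: powr_diff)
        then have "ennreal (min 1 (c * \<tau>) * \<tau> powr (-\<alpha> - 1)) \<le> ennreal c * ennreal (\<tau> powr (-\<alpha>))"
          using assms by (metis ennreal_leI ennreal_mult less_imp_le min.cobounded2 mult_right_mono powr_ge_zero)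
        then show ?thesis
          using True le by (auto simp: indicator_def intro: add_increasing2)
      next
        case False
        have "ennreal (min 1 (c * \<tau>) * \<tau> powr (-\<alpha> - 1)) \<le> ennreal (\<tau> powr (-\<alpha> - 1))"
          using mult_right_mono[of "min 1 (c * \<tau>)" 1 "\<tau> powr (-\<alpha> - 1)"] by (intro ennreal_leI) simp
        then show ?thesis
          using True False by (auto simp: indicator_def)
      qed
    qed simp
  qed
  also have "\<dots> = ennreal c * ennreal (?d powr (1 - \<alpha>) / (1 - \<alpha>)) + ennreal (?d powr (-\<alpha>) / \<alpha>)"
    by (subst nn_integral_add; (subst nn_integral_cmult)?; (simp only: I1 I2)?)
      (auto intro!: measurable_completion)
  also have "\<dots> = ennreal (c * (?d powr (1 - \<alpha>) / (1 - \<alpha>)) + ?d powr (-\<alpha>) / \<alpha>)"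
    using assms by (simp del: times_divide_eq_right add: ennreal_mult)
  also have "c * (?d powr (1 - \<alpha>) / (1 - \<alpha>)) + ?d powr (-\<alpha>) / \<alpha> = c powr \<alpha> * (1 / (1 - \<alpha>) + 1 / \<alpha>)"
    using assms by (simp add: powr_divide powr_diff powr_minus field_simps)
  finally show ?thesis by simp
qed

text \<open>The weighted sum of the coefficients controls both inputs of
  \<open>besov_seminorm_finite\<close>: the Hoelder constant \<open>C\<close> through
  \<open>min_one_le_powr\<close>, and the integral of the majorant through
  \<open>nn_integral_min_powr_le\<close> with \<open>c = 2 ^ n\<close>.\<close>

lemma takagi_besov:
  assumes \<alpha>: "0 < \<alpha>" "\<alpha> < 1" and pq: "1 \<le> p" "1 \<le> q"
    and a: "\<And>n. 0 \<le> a n" "summable (\<lambda>n. a n * (2 ^ n) powr \<alpha>)"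
  shows "continuous_on {0..1} (takagi a)" "takagi a \<in> besov \<alpha> p q"
proof -
  define C where "C = (\<Sum>n. a n * (2 ^ n) powr \<alpha>)"
  \<comment> \<open>The absolute value makes \<open>W\<close> nonnegative and even on the whole
    line, so it can be evaluated at signed differences \<open>x - y\<close>.\<close>
  define W where "W = (\<lambda>\<tau>. \<Sum>n. a n * min 1 (2 ^ n * \<bar>\<tau>\<bar>))"
  have "norm (a n) \<le> a n * (2 ^ n) powr \<alpha>" for n
    using mult_left_mono[OF ge_one_powr_ge_zero[of "2 ^ n" \<alpha>] a(1)[of n]] \<alpha> a(1)[of n] by simp
  then have sa: "summable a"
    by (intro summable_comparison_test'[OF a(2)])
  note sW = takagi_modulus_summable[OF a(1) sa]
  have C0: "0 \<le> C"
    unfolding C_def using a by (intro suminf_nonneg) auto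
  have W0: "0 \<le> W \<tau>" for \<tau>
    unfolding W_def using a(1) by (intro suminf_nonneg sW) auto
  have WC: "W \<tau> \<le> C * \<bar>\<tau>\<bar> powr \<alpha>" for \<tau>
  proof -
    have "W \<tau> \<le> (\<Sum>n. a n * (2 ^ n) powr \<alpha> * \<bar>\<tau>\<bar> powr \<alpha>)"
      unfolding W_def
    proof (intro suminf_le sW summable_mult2 a(2))
      fix n
      show "a n * min 1 (2 ^ n * \<bar>\<tau>\<bar>) \<le> a n * (2 ^ n) powr \<alpha> * \<bar>\<tau>\<bar> powr \<alpha>"
        using min_one_le_powr[of "2 ^ n * \<bar>\<tau>\<bar>" \<alpha>] a(1)[of n] \<alpha>
        by (simp add: powr_mult mult_left_mono mult.assoc)
    qed
    then show ?thesis
      by (simp add: C_def suminf_mult2[OF a(2)])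
  qed
  \<comment> \<open>The modulus at \<open>\<tau>\<close> is a supremum over all shifts up to
    \<open>\<tau>\<close>, so the bound at \<open>h\<close> has to pass to
    \<open>\<tau>\<close>.\<close>
  have W_mono: "W h \<le> W \<tau>" if "0 \<le> h" "h \<le> \<tau>" for h \<tau>
    unfolding W_def using that a(1)
    by (intro suminf_le sW mult_left_mono min.mono) auto
  have W_meas: "W \<in> borel_measurable borel"
    unfolding W_def by measurable
  have diff: "\<bar>takagi a x - takagi a y\<bar> \<le> W (x - y)" for x y
    unfolding W_def by (rule takagi_diff_le[OF a(1) sa])
  show cont: "continuous_on {0..1} (takagi a)"
    unfolding continuous_on_def
  proof
    fix x :: real
    have "((\<lambda>y. C * \<bar>y - x\<bar> powr \<alpha>) \<longlongrightarrow> 0) (at x within {0..1})"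
      by (rule tendsto_eq_intros refl | use \<alpha> in simp)+
    then have "((\<lambda>y. takagi a y - takagi a x) \<longlongrightarrow> 0) (at x within {0..1})"
      by (rule Lim_null_comparison[rotated])
        (use order_trans[OF diff WC] in \<open>simp add: always_eventually\<close>)
    then show "(takagi a \<longlongrightarrow> takagi a x) (at x within {0..1})"
      by (simp add: LIM_zero_iff)
  qed
  have "modulus p (takagi a) \<tau> \<le> ennreal (W \<tau>)" for \<tau>
    using pq(1) W0
  proof (rule modulus_le)
    fix s h :: real
    assume "0 \<le> h" "h \<le> \<tau>"
    then show "\<bar>takagi a (s + h) - takagi a s\<bar> \<le> W \<tau>"
      using diff[of "s + h" s] W_mono[of h \<tau>] by simp
  qed
  moreover have "(\<integral>\<^sup>+\<tau>\<in>{0<..1}. ennreal (W \<tau> * \<tau> powr (-\<alpha> - 1)) \<partial>lebesgue) < \<infinity>"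
  proof -
    define K where "K = 1 / (1 - \<alpha>) + 1 / \<alpha>"
    \<comment> \<open>With the indicator inside \<open>g\<close>, the series identity below holds
      for every real \<open>\<tau>\<close>, and the integral can be exchanged with the sum.\<close>
    define g where "g = (\<lambda>n \<tau>. ennreal (min 1 (2 ^ n * \<tau>) * \<tau> powr (-\<alpha> - 1)) * indicator {0<..1::real} \<tau>)"
    have K: "0 \<le> K" using \<alpha> by (simp add: K_def)
    have "ennreal (W \<tau> * \<tau> powr (-\<alpha> - 1)) * indicator {0<..1} \<tau> = (\<Sum>n. ennreal (a n) * g n \<tau>)" for \<tau>
    proof (cases "\<tau> \<in> {0<..1}")
      case True
      have "W \<tau> * \<tau> powr (-\<alpha> - 1) = (\<Sum>n. a n * min 1 (2 ^ n * \<bar>\<tau>\<bar>) * \<tau> powr (-\<alpha> - 1))"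
        unfolding W_def by (rule suminf_mult2[OF sW])
      also have "ennreal \<dots> = (\<Sum>n. ennreal (a n * min 1 (2 ^ n * \<bar>\<tau>\<bar>) * \<tau> powr (-\<alpha> - 1)))"
        using a(1) by (intro suminf_ennreal2[symmetric] summable_mult2 sW) auto
      also have "\<dots> = (\<Sum>n. ennreal (a n) * g n \<tau>)"
        using True a(1) by (intro suminf_cong) (simp add: g_def mult.assoc flip: ennreal_mult)
      finally show ?thesis using True by simp
    qed (simp add: g_def)
    then have "(\<integral>\<^sup>+\<tau>\<in>{0<..1}. ennreal (W \<tau> * \<tau> powr (-\<alpha> - 1)) \<partial>lebesgue)
        = (\<integral>\<^sup>+\<tau>. (\<Sum>n. ennreal (a n) * g n \<tau>) \<partial>lebesgue)"
      by simp
    also have "\<dots> = (\<Sum>n. \<integral>\<^sup>+\<tau>. ennreal (a n) * g n \<tau> \<partial>lebesgue)"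
      unfolding g_def by (intro nn_integral_suminf measurable_completion) measurable
    also have "\<dots> = (\<Sum>n. ennreal (a n) * (\<integral>\<^sup>+\<tau>. g n \<tau> \<partial>lebesgue))"
      unfolding g_def by (intro suminf_cong nn_integral_cmult measurable_completion) measurable
    also have "\<dots> \<le> (\<Sum>n. ennreal (a n * (2 ^ n) powr \<alpha> * K))"
    proof (intro suminf_le)
      fix n
      have "(\<integral>\<^sup>+\<tau>. g n \<tau> \<partial>lebesgue) \<le> ennreal ((2 ^ n) powr \<alpha> * K)"
        unfolding g_def K_def by (rule nn_integral_min_powr_le) (use \<alpha> in auto)
      then show "ennreal (a n) * (\<integral>\<^sup>+\<tau>. g n \<tau> \<partial>lebesgue) \<le> ennreal (a n * (2 ^ n) powr \<alpha> * K)"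
        using a(1)[of n] K by (simp add: mult.assoc ennreal_mult mult_left_mono)
    qed auto
    also have "\<dots> = ennreal (\<Sum>n. a n * (2 ^ n) powr \<alpha> * K)"
      using a K by (intro suminf_ennreal2 summable_mult2) auto
    finally show ?thesis
      by (rule le_less_trans) simp
  qed
  moreover have "0 \<le> W \<tau> \<and> W \<tau> \<le> C * \<tau> powr \<alpha>" if "0 < \<tau>" for \<tau>
    using W0[of \<tau>] WC[of \<tau>] that by simp
  ultimately have "besov_seminorm \<alpha> p q (takagi a) < \<infinity>"
    by (intro besov_seminorm_finite[OF pq(2) C0 _ _ _ W_meas])
  then show "takagi a \<in> besov \<alpha> p q"
    using continuous_imp_Lp_space[OF cont] by (simp add: besov_def)
qed

section \<open>Choice of the coefficients and divergence of the variation\<close>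

theorem proposition2p2:
  fixes \<alpha> :: real and p q :: ennreal
  assumes "0 < \<alpha>" and "\<alpha> < 1"
    and "1 \<le> q" and "q \<le> p"
    and "1 / p < ennreal \<alpha>"
  shows "\<exists>f :: real \<Rightarrow> real.
           continuous_on {0..1} f \<and> f \<in> besov \<alpha> p q \<and>
           (\<forall>r :: real. 1 \<le> r \<and> r < 1 / \<alpha> \<longrightarrow> f \<notin> finite_variation r)"
proof -
  \<comment> \<open>The exponential factor cancels the weight \<open>(2 ^ n) powr \<alpha>\<close>
    exactly. The remaining inverse square is summable, yet decays only polynomially and so cannot
    offset exponential growth of the variation bound.\<close>
  define a :: "nat \<Rightarrow> real" where "a = (\<lambda>n. 2 powr (- \<alpha> * n) / (real (Suc n))\<^sup>2)"
  have a0: "0 \<le> a n" for n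
    by (simp add: a_def)
  have sq: "summable (\<lambda>n. 1 / (real (Suc n))\<^sup>2)"
    using inverse_power_summable[of 2, where 'a = real]
    by (subst summable_Suc_iff) (simp add: inverse_eq_divide)
  have "a n * (2 ^ n) powr \<alpha> = 1 / (real (Suc n))\<^sup>2" for n
  proof -
    have "(2 ^ n) powr \<alpha> = 2 powr (\<alpha> * n)"
      by (simp add: powr_powr mult.commute flip: powr_realpow)
    then have "2 powr (- \<alpha> * n) * (2 ^ n) powr \<alpha> = 1"
      by (simp flip: powr_add)
    then show ?thesis by (simp add: a_def)
  qed
  then have weighted: "summable (\<lambda>n. a n * (2 ^ n) powr \<alpha>)"
    using sq by simp
  have "a n \<le> 1 / (real (Suc n))\<^sup>2" for n
  proof -
    have "2 powr (- \<alpha> * n) \<le> 2 powr 0"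
      using assms(1) by (intro powr_mono) auto
    then show ?thesis unfolding a_def by (intro divide_right_mono) auto
  qed
  then have sa: "summable a"
    using a0 by (intro summable_comparison_test'[OF sq]) auto
  have "takagi a \<notin> finite_variation r" if r: "1 \<le> r" "r < 1 / \<alpha>" for r
  proof
    assume "takagi a \<in> finite_variation r"
    then have "variation r (takagi a) < top"
      by (simp add: finite_variation_def)
    then obtain v where v: "0 \<le> v" "variation r (takagi a) = ennreal v"
      by (cases "variation r (takagi a)") auto
    \<comment> \<open>The exponential rate left when \<open>2 powr (n / r)\<close> meets the decay
      of \<open>a n\<close>; it is positive precisely because
      \<open>r < 1 / \<alpha>\<close>.\<close>
    define \<delta> where "\<delta> = 1 / r - \<alpha>"
    have "0 < \<delta>"
      using r assms(1) by (simp add: \<delta>_def field_simps)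
    then have "filterlim (\<lambda>n. 2 powr (\<delta> * real n) / (2 * (real n + 1)\<^sup>2)) at_top sequentially"
      by real_asymp
    then have "eventually (\<lambda>n. v < 2 powr (\<delta> * real n) / (2 * (real n + 1)\<^sup>2)) sequentially"
      by (simp add: filterlim_at_top_dense)
    then obtain n where n: "v < 2 powr (\<delta> * real n) / (2 * (real n + 1)\<^sup>2)"
      by (auto simp: eventually_sequentially)
    have "2 powr (n / r) * (a n / 2) = 2 powr (\<delta> * real n) / (2 * (real n + 1)\<^sup>2)"
    proof -
      have "2 powr (\<delta> * real n) = 2 powr (n / r) * 2 powr (- \<alpha> * n)"
        by (simp add: \<delta>_def left_diff_distrib flip: powr_add)
      then show ?thesis by (simp add: a_def add.commute)
    qed
    then have "2 powr (\<delta> * real n) / (2 * (real n + 1)\<^sup>2) \<le> v"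
      using takagi_variation_ge[OF a0 sa r(1), of n] v by (simp add: ennreal_le_iff)
    then show False using n by simp
  qed
  then show ?thesis
    using takagi_besov[OF assms(1,2) order_trans[OF assms(3,4)] assms(3) a0 weighted] by blast
qed

end
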